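(* Let $A$ be a real $m\times n$ matrix whose minimal entry is $0$ and maximal entry is $1$, and let switching costs be uniform, i.e. $S=(s_{ij})$ is the $n\times n$ matrix with $s_{ij}=1$ for $i\ne j$ and $s_{ii}=0$. Then for every $c\ge0$, Player 2's loss from limiting himself to static strategies in the game $(A,S,c)$ satisfies $$\tilde v(c)-v(c)\ \le\ \Delta(c)=\tfrac12\Big(1+c\big(1-\tfrac1n\big)-v(c)\Big).$$
   Context: A zero-sum game with switching costs is a tuple $(A,S,c)$ where $A=(a_{ij})$ is a real $m\times n$ matrix, $c\ge 0$, and $S=(s_{kj})$ is an $n\times n$ matrix with nonnegative entries and zero diagonal. At each stage $t=1,2,\dots$, Player 1 (the maximizer) chooses a row $i(t)$ and Player 2 (the minimizer) simultaneously chooses a column $j(t)$, possibly at random, knowing the history of realized actions. The stage payoff, paid by Player 2 to Player 1, is $u_t=a_{i(t)j(t)}+c\,s_{j(t-1)j(t)}$, with no switching cost paid at $t=1$. For a strategy pair $(\sigma,\tau)$ the payoff is $\gamma(\sigma,\tau)=\mathbb{E}_{\sigma,\tau}\big(\liminf_{T\to\infty}\frac1T\sum_{t=1}^T u_t\big)$. A stationary strategy is one in which the mixed action at stage $t$ depends only on the previous action $j(t-1)$ of Player 2 (at stage 1 a fixed arbitrary initial state $j(0)$ plays the role of the previous action). The game has a value $v(c)$, attained by stationary strategies of both players. A static strategy plays the same mixed action at every stage regardless of history. The minimax value in static strategies is $\tilde v(c)=\min_{y\in\Delta(\{1,\dots,n\})}\max_{x\in\Delta(\{1,\dots,m\})}\{x^TAy+c\,y^TSy\}$.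 *)

theory Defs
  imports "HOL-Probability.Probability"
begin

text \<open>
  Rows are indexed by the finite type \<^typ>\<open>'m\<close> and columns by \<^typ>\<open>'n\<close>. A play is a
  sequence \<open>\<omega> :: nat \<Rightarrow> 'm \<times> 'n\<close> of realized action pairs; stages are numbered from \<open>0\<close>,
  so \<open>\<omega> t\<close> is the action pair of the stage usually numbered \<open>t + 1\<close>.
  A (behaviour) strategy maps the finite history of realized pairs, oldest first, to a mixed action.
\<close>

type_synonym ('m, 'n) history = "('m \<times> 'n) list"
type_synonym ('m, 'n) strategy1 = "('m, 'n) history \<Rightarrow> 'm pmf"
type_synonym ('m, 'n) strategy2 = "('m, 'n) history \<Rightarrow> 'n pmf"

text \<open>
  Only \<open>\<omega> 0, \<dots>, \<omega> (t - 1)\<close> enter the law of stage \<open>t\<close>; the players randomize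
  independently given the history.
\<close>

definition stage_law ::
    "('m, 'n) strategy1 \<Rightarrow> ('m, 'n) strategy2 \<Rightarrow> nat \<Rightarrow> (nat \<Rightarrow> 'm \<times> 'n) \<Rightarrow> ('m \<times> 'n) measure" where
  "stage_law \<sigma> \<tau> t \<omega> = measure_pmf (let h = map \<omega> [0..<t] in pair_pmf (\<sigma> h) (\<tau> h))"

lemma Ionescu_Tulcea_stage_law:
  fixes \<sigma> :: "('m::finite, 'n::finite) strategy1" and \<tau> :: "('m, 'n) strategy2"
  shows "Ionescu_Tulcea (stage_law \<sigma> \<tau>) (\<lambda>_. count_space UNIV)"
proof (rule Ionescu_Tulcea.intro)
  fix t :: nat
  let ?M = "PiM {0..<t} (\<lambda>_. count_space (UNIV :: ('m \<times> 'n) set))"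
  have M: "?M = count_space ({0..<t} \<rightarrow>\<^sub>E UNIV)"
    by (intro count_space_PiM_finite) auto
  have "measure_pmf p \<in> space (subprob_algebra (count_space UNIV))" for p :: "('m \<times> 'n) pmf"
    by (simp add: space_subprob_algebra prob_space_imp_subprob_space prob_space_measure_pmf)
  then show "stage_law \<sigma> \<tau> t \<in> measurable ?M (subprob_algebra (count_space UNIV))"
    unfolding M by (auto simp: stage_law_def)
  fix \<omega> :: "nat \<Rightarrow> 'm \<times> 'n"
  assume "\<omega> \<in> space ?M"
  show "prob_space (stage_law \<sigma> \<tau> t \<omega>)"
    by (simp add: stage_law_def prob_space_measure_pmf)
qed

text \<open>
  The law of the play: the Ionescu-Tulcea extension of the stage laws, a measure on
  the product sigma-algebra.
\<close>

definition play ::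
    "('m::finite, 'n::finite) strategy1 \<Rightarrow> ('m, 'n) strategy2 \<Rightarrow> (nat \<Rightarrow> 'm \<times> 'n) measure" where
  "play \<sigma> \<tau> = projective_family.lim UNIV
     (Ionescu_Tulcea.CI (stage_law \<sigma> \<tau>) (\<lambda>_. count_space UNIV)) (\<lambda>_. count_space UNIV)"

lemma
  fixes \<sigma> :: "('m::finite, 'n::finite) strategy1" and \<tau> :: "('m, 'n) strategy2"
  shows sets_play: "sets (play \<sigma> \<tau>) = sets (PiM UNIV (\<lambda>_. count_space UNIV))"
    and prob_space_play: "prob_space (play \<sigma> \<tau>)"
proof -
  interpret Ionescu_Tulcea "stage_law \<sigma> \<tau>" "\<lambda>_. count_space (UNIV :: ('m \<times> 'n) set)"
    by (rule Ionescu_Tulcea_stage_law)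
  show "sets (play \<sigma> \<tau>) = sets (PiM UNIV (\<lambda>_. count_space UNIV))"
    by (simp add: play_def)
  have "emeasure PF.lim (PF.emb UNIV {} {\<lambda>_. undefined}) = emeasure (CI {}) {\<lambda>_. undefined}"
    by (rule lim) (auto simp: PiM_empty)
  moreover have "PF.emb UNIV {} {\<lambda>_. undefined} = space PF.lim"
    by (auto simp: prod_emb_def space_PiM)
  moreover have "emeasure (CI {}) {\<lambda>_. undefined} = 1"
    using prob_space.emeasure_space_1[OF PF.prob_space_P[of "{}"]]
    by (simp add: PF.space_P PiM_empty)
  ultimately show "prob_space (play \<sigma> \<tau>)"
    unfolding play_def by (intro prob_spaceI) simp
qed

definition stage_payoff ::
    "real^'n^'m \<Rightarrow> real^'n^'n \<Rightarrow> real \<Rightarrow> (nat \<Rightarrow> 'm \<times> 'n) \<Rightarrow> nat \<Rightarrow> real" where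
  "stage_payoff A S c \<omega> t =
     A $ fst (\<omega> t) $ snd (\<omega> t) +
     (if t = 0 then 0 else c * S $ snd (\<omega> (t - 1)) $ snd (\<omega> t))"

text \<open>
  The averages are bounded, so the limit inferior, taken in the extended reals, is finite.
\<close>

definition payoff ::
    "real^'n^'m \<Rightarrow> real^'n^'n \<Rightarrow> real \<Rightarrow>
     ('m::finite, 'n::finite) strategy1 \<Rightarrow> ('m, 'n) strategy2 \<Rightarrow> real" where
  "payoff A S c \<sigma> \<tau> =
     (LINT \<omega>|play \<sigma> \<tau>.
        real_of_ereal (liminf (\<lambda>T. ereal ((\<Sum>t<T. stage_payoff A S c \<omega> t) / real T))))"

text \<open>
  All the suprema and infima below are over bounded nonempty sets of reals.
\<close>

definition is_game_value ::
    "real^'n^'m \<Rightarrow> real^'n^'n \<Rightarrow> real \<Rightarrow> real \<Rightarrow> bool" where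
  "is_game_value A S c v \<longleftrightarrow>
     v = (SUP \<sigma>. INF \<tau>. payoff A S c \<sigma> \<tau>) \<and>
     v = (INF \<tau>. SUP \<sigma>. payoff A S c \<sigma> \<tau>)"

definition mixed :: "(real^'k) set" where
  "mixed = {x. (\<forall>i. 0 \<le> x $ i) \<and> (\<Sum>i\<in>UNIV. x $ i) = 1}"

text \<open>
  By compactness of \<^const>\<open>mixed\<close> and continuity, the infimum and the suprema are attained.
\<close>

definition static_value :: "real^'n^'m \<Rightarrow> real^'n^'n \<Rightarrow> real \<Rightarrow> real" where
  "static_value A S c =
     (INF y\<in>mixed. SUP x\<in>mixed. x \<bullet> (A *v y) + c * (y \<bullet> (S *v y)))"

definition uniform_costs :: "real^'n^'n" where
  "uniform_costs = (\<chi> i j. if i = j then 0 else 1)"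

end

theory Submission
  imports Defs
begin

text \<open>
  Write \<open>n\<close> for the number of columns and \<open>s\<close> for the static value. The bound is half the
  sum of two estimates, \<open>s \<le> 1\<close> and \<open>s \<le> v + c (1 - 1/n)\<close>.

  The first holds because one column played at every stage never pays a switching cost and no entry exceeds 1.

  For the second, a static \<open>y\<close> switches with probability \<open>1 - \<Sum>j. y\<^sub>j\<^sup>2 \<le> 1 - 1/n\<close>. Hence, with
  \<open>w = s - c (1 - 1/n)\<close>, every mixed column \<open>y\<close> has a row earning at least \<open>w\<close> against it in
  the matrix game \<open>A\<close> alone; otherwise \<open>y\<close> played statically would cost less than \<open>s\<close>. Given any
  strategy of Player 2, Player 1 may therefore answer, after each history, with a pure row
  whose conditional expected entry is at least \<open>w\<close> (\<open>game_value_ge\<close>). Switching costs only add to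
  what he gets, so the long-run average is almost surely at least \<open>w\<close> and \<open>w \<le> v\<close> follows from
  the characterization of \<open>v\<close> as an infimum over Player 2's strategies.

  The almost sure bound on the averages needs a law of large numbers for history-dependent
  play. It comes from exponential moments: a bounded stage quantity with conditional means at
  least \<open>\<delta> > 0\<close> has \<open>E (exp (- l d)) \<le> r < 1\<close> conditionally on every history for a suitable \<open>l > 0\<close>,
  so the expectation of the product over \<open>T\<close> stages is at most \<open>r ^ T\<close> and the Borel-Cantelli lemma
  applies (\<open>AE_play_sum_pos\<close>).
\<close>

section \<open>A law of large numbers for history-dependent play\<close>

text \<open>
  For negative arguments the inequality follows from a lower bound on \<open>exp (- x)\<close>, because
  \<open>(1 - y + y\<^sup>2) (1 + y + y\<^sup>2 / 2) \<ge> 1\<close> for \<open>y \<ge> 0\<close>.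
\<close>

lemma exp_le_quadratic:
  fixes x :: real
  assumes "x \<le> 1"
  shows "exp x \<le> 1 + x + x\<^sup>2"
proof (cases "0 \<le> x")
  case True
  then show ?thesis using assms by (rule exp_bound)
next
  case False
  define y where "y = - x"
  have y: "0 < y" using False by (simp add: y_def)
  have low: "1 + y + y\<^sup>2 / 2 \<le> exp y"
    using y by (intro exp_lower_Taylor_quadratic) simp
  have pos: "0 < 1 - y + y\<^sup>2"
  proof -
    have "0 \<le> (y - 1 / 2)\<^sup>2" by simp
    then show ?thesis by (simp add: power2_eq_square algebra_simps)
  qed
  have "1 \<le> (1 - y + y\<^sup>2) * (1 + y + y\<^sup>2 / 2)"
  proof -
    have "(1 - y + y\<^sup>2) * (1 + y + y\<^sup>2 / 2) = 1 + (y\<^sup>2 + y ^ 3 + y ^ 4) / 2"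
      by (simp add: field_simps power2_eq_square power3_eq_cube power4_eq_xxxx)
    then show ?thesis using y by simp
  qed
  also have "\<dots> \<le> (1 - y + y\<^sup>2) * exp y"
    using low pos by (intro mult_left_mono) auto
  finally have "exp (- y) \<le> 1 - y + y\<^sup>2"
    by (simp add: exp_minus field_simps)
  then show ?thesis by (simp add: y_def)
qed

text \<open>
  Conditioning on the first \<open>T - 1\<close> stages bounds the last factor by \<open>\<rho>\<close> whatever the history, so
  the bounds multiply although the stages need not be independent. This is the only point at
  which the construction of the law of the play is opened.
\<close>

lemma nn_integral_prod_play_le:
  fixes \<sigma> :: "('m::finite, 'n::finite) strategy1" and \<tau> :: "('m, 'n) strategy2"
    and g :: "'m \<times> 'n \<Rightarrow> ennreal"
  assumes g: "\<And>h. (\<integral>\<^sup>+p. g p \<partial>pair_pmf (\<sigma> h) (\<tau> h)) \<le> \<rho>"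
  shows "(\<integral>\<^sup>+\<omega>. (\<Prod>t<T. g (\<omega> t)) \<partial>play \<sigma> \<tau>) \<le> \<rho> ^ T"
proof -
  interpret Ionescu_Tulcea "stage_law \<sigma> \<tau>" "\<lambda>_. count_space (UNIV :: ('m \<times> 'n) set)"
    by (rule Ionescu_Tulcea_stage_law)
  let ?M = "\<lambda>n :: nat. PiM {0..<n} (\<lambda>_. count_space (UNIV :: ('m \<times> 'n) set))"
  let ?F = "\<lambda>(n :: nat) \<omega>. \<Prod>t<n. g (\<omega> t)"
  have meas_F: "?F n \<in> borel_measurable (?M m)" if "n \<le> m" for n m
  proof (intro borel_measurable_prod_ennreal)
    fix t assume "t \<in> {..<n}"
    with that have "t \<in> {0..<m}" by auto
    then have "(\<lambda>\<omega>. \<omega> t) \<in> measurable (?M m) (count_space UNIV)"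
      by (rule measurable_component_singleton)
    then show "(\<lambda>\<omega>. g (\<omega> t)) \<in> borel_measurable (?M m)"
      by (rule measurable_compose) simp
  qed
  have start: "(\<lambda>_. undefined) \<in> space (?M 0)"
    by (simp add: space_PiM)
  have C_le: "(\<integral>\<^sup>+\<omega>. ?F n \<omega> \<partial>C 0 n (\<lambda>_. undefined)) \<le> \<rho> ^ n" for n
  proof (induction n)
    case 0
    show ?case
      using prob_space.emeasure_space_1[OF prob_space_C[OF start, of 0]] by simp
  next
    case (Suc n)
    let ?C = "C 0 n (\<lambda>_. undefined)"
    have sp: "space ?C = space (?M n)" using space_C[OF start, of n] by simp
    have st: "sets ?C = sets (?M n)" using sets_C[OF start, of n] by simp
    have eP: "eP n \<in> measurable ?C (subprob_algebra (?M (Suc n)))"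
      using measurable_eP[of n] measurable_cong_sets[OF st refl] by blast
    have "(\<integral>\<^sup>+\<omega>. ?F (Suc n) \<omega> \<partial>C 0 (Suc n) (\<lambda>_. undefined))
        = (\<integral>\<^sup>+\<omega>. (\<integral>\<^sup>+\<omega>'. ?F (Suc n) \<omega>' \<partial>eP n \<omega>) \<partial>?C)"
      using nn_integral_bind[OF meas_F[OF order_refl] eP]
      by (simp only: C.simps add_0)
    also have "\<dots> \<le> (\<integral>\<^sup>+\<omega>. ?F n \<omega> * \<rho> \<partial>?C)"
    proof (rule nn_integral_mono)
      fix \<omega> assume "\<omega> \<in> space ?C"
      then have \<omega>: "\<omega> \<in> space (?M n)" by (simp add: sp)
      let ?h = "map \<omega> [0..<n]"
      have "(\<integral>\<^sup>+\<omega>'. ?F (Suc n) \<omega>' \<partial>eP n \<omega>)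
          = (\<integral>\<^sup>+p. ?F (Suc n) (fun_upd \<omega> n p) \<partial>stage_law \<sigma> \<tau> n \<omega>)"
        by (rule nn_integral_eP[OF \<omega> meas_F]) simp
      also have "\<dots> = (\<integral>\<^sup>+p. ?F n \<omega> * g p \<partial>pair_pmf (\<sigma> ?h) (\<tau> ?h))"
        by (simp add: stage_law_def Let_def)
      also have "\<dots> = ?F n \<omega> * (\<integral>\<^sup>+p. g p \<partial>pair_pmf (\<sigma> ?h) (\<tau> ?h))"
        by (rule nn_integral_cmult) simp
      also have "\<dots> \<le> ?F n \<omega> * \<rho>" using g by (rule mult_left_mono) simp
      finally show "(\<integral>\<^sup>+\<omega>'. ?F (Suc n) \<omega>' \<partial>eP n \<omega>) \<le> ?F n \<omega> * \<rho>" .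
    qed
    also have "\<dots> = (\<integral>\<^sup>+\<omega>. ?F n \<omega> \<partial>?C) * \<rho>"
      by (rule nn_integral_multc) (use meas_F[of n n] measurable_cong_sets[OF st refl] in blast)
    also have "\<dots> \<le> \<rho> ^ n * \<rho>" using Suc.IH by (rule mult_right_mono) simp
    finally show ?case by (simp add: mult.commute)
  qed
  \<comment> \<open>Transfer from the law of the first \<open>T\<close> stages to the law of the infinite play.\<close>
  have up: "up_to {0..<T} = T"
  proof (rule antisym)
    show "up_to {0..<T} \<le> T" by (simp add: up_to_iff)
    show "T \<le> up_to {0..<T}" using up_to[of "{0..<T}"] by (cases "T = 0") auto
  qed
  have restr: "(\<lambda>\<omega>. restrict \<omega> {0..<T}) \<in> measurable PF.lim (?M T)"
    by (subst measurable_cong_sets[OF PF.sets_lim refl]) (rule measurable_restrict_subset, simp)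
  have stC: "sets (C 0 T (\<lambda>_. undefined)) = sets (?M T)" using sets_C[OF start, of T] by simp
  have restrC: "(\<lambda>\<omega>. restrict \<omega> {0..<T}) \<in> measurable (C 0 T (\<lambda>_. undefined)) (?M T)"
    by (subst measurable_cong_sets[OF stC refl]) (rule measurable_restrict_subset, simp)
  have "(\<integral>\<^sup>+\<omega>. ?F T \<omega> \<partial>play \<sigma> \<tau>) = (\<integral>\<^sup>+\<omega>. ?F T (restrict \<omega> {0..<T}) \<partial>PF.lim)"
    unfolding play_def by (intro nn_integral_cong prod.cong) auto
  also have "\<dots> = (\<integral>\<^sup>+\<omega>. ?F T \<omega> \<partial>distr PF.lim (?M T) (\<lambda>\<omega>. restrict \<omega> {0..<T}))"
    by (rule nn_integral_distr[symmetric, OF restr]) (use meas_F[of T T] in simp)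
  also have "\<dots> = (\<integral>\<^sup>+\<omega>. ?F T \<omega> \<partial>CI {0..<T})"
    by (simp add: distr_lim)
  also have "\<dots> = (\<integral>\<^sup>+\<omega>. ?F T (restrict \<omega> {0..<T}) \<partial>C 0 T (\<lambda>_. undefined))"
    unfolding CI_def up by (rule nn_integral_distr[OF restrC]) (use meas_F[of T T] in simp)
  also have "\<dots> = (\<integral>\<^sup>+\<omega>. ?F T \<omega> \<partial>C 0 T (\<lambda>_. undefined))"
    by (intro nn_integral_cong prod.cong) auto
  finally show ?thesis using C_le[of T] by simp
qed

lemma measurable_play_component [measurable]:
  "(\<lambda>\<omega>. \<omega> t) \<in> measurable (play \<sigma> \<tau>) (count_space UNIV)"
  by (subst measurable_cong_sets[OF sets_play refl]) (rule measurable_component_singleton, simp)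

text \<open>
  A supermartingale argument: the event that the sum over \<open>T\<close> stages is nonpositive forces
  \<open>\<Prod>t<T. exp (- l d)\<close> to be at least 1, and the expectation of that product decays geometrically.
\<close>

lemma AE_play_sum_pos:
  fixes \<sigma> :: "('m::finite, 'n::finite) strategy1" and \<tau> :: "('m, 'n) strategy2"
    and d :: "'m \<times> 'n \<Rightarrow> real"
  assumes drift: "\<And>h. \<delta> \<le> measure_pmf.expectation (pair_pmf (\<sigma> h) (\<tau> h)) d"
    and \<delta>: "0 < \<delta>"
  shows "AE \<omega> in play \<sigma> \<tau>. \<forall>\<^sub>F T in sequentially. 0 < (\<Sum>t<T. d (\<omega> t))"
proof -
  interpret prob_space "play \<sigma> \<tau>" by (rule prob_space_play)
  define B where "B = Max (range (\<lambda>p. \<bar>d p\<bar>))"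
  have d_B: "\<bar>d p\<bar> \<le> B" for p unfolding B_def by (intro Max_ge) auto
  have int: "integrable (measure_pmf q) f" for q :: "('m \<times> 'n) pmf" and f :: "_ \<Rightarrow> real"
    by (rule integrable_measure_pmf_finite) simp
  have "\<delta> \<le> B"
  proof -
    have "measure_pmf.expectation (pair_pmf (\<sigma> []) (\<tau> [])) d \<le> B"
      using d_B by (intro measure_pmf.integral_le_const int) (auto simp: abs_le_iff)
    with drift[of "[]"] show ?thesis by simp
  qed
  with \<delta> have B: "0 < B" by simp
  \<comment> \<open>The estimate below gives the conditional bound \<open>1 - l \<delta> + l\<^sup>2 B\<^sup>2\<close>, which \<open>l = \<delta> / (2 B\<^sup>2)\<close>
    minimizes; \<open>r\<close> is that minimum.\<close>
  define l where "l = \<delta> / (2 * B\<^sup>2)"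
  define r where "r = 1 - \<delta>\<^sup>2 / (4 * B\<^sup>2)"
  have l: "0 < l" using \<delta> B by (simp add: l_def)
  have lB: "l * B \<le> 1"
    using \<open>\<delta> \<le> B\<close> B by (simp add: l_def field_simps power2_eq_square)
  have r1: "r < 1" using \<delta> B by (simp add: r_def)
  have r0: "0 \<le> r"
  proof -
    have "\<delta>\<^sup>2 \<le> B\<^sup>2" using \<open>\<delta> \<le> B\<close> \<delta> by (intro power_mono) auto
    then have "\<delta>\<^sup>2 \<le> 4 * B\<^sup>2" using zero_le_power2[of B] by linarith
    then show ?thesis using B by (simp add: r_def field_simps)
  qed
  have contract: "(\<integral>\<^sup>+p. ennreal (exp (- l * d p)) \<partial>pair_pmf (\<sigma> h) (\<tau> h)) \<le> ennreal r" for h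
  proof -
    let ?E = "measure_pmf.expectation (pair_pmf (\<sigma> h) (\<tau> h))"
    have pt: "exp (- l * d p) \<le> 1 + (l * B)\<^sup>2 - l * d p" for p
    proof -
      have "\<bar>l * d p\<bar> \<le> l * B" using d_B[of p] l by (simp add: abs_mult)
      then have "(l * d p)\<^sup>2 \<le> (l * B)\<^sup>2" and "- l * d p \<le> 1"
        using lB by (auto simp: abs_le_square_iff[symmetric])
      then show ?thesis using exp_le_quadratic[of "- l * d p"] by simp
    qed
    have "?E (\<lambda>p. exp (- l * d p)) \<le> ?E (\<lambda>p. 1 + (l * B)\<^sup>2 - l * d p)"
      by (intro integral_mono int pt)
    also have "\<dots> = 1 + (l * B)\<^sup>2 - l * ?E d"
      by (subst Bochner_Integration.integral_diff) (auto intro: int)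
    also have "\<dots> \<le> 1 + (l * B)\<^sup>2 - l * \<delta>"
      using drift[of h] l by simp
    also have "\<dots> = r"
      using B by (simp add: l_def r_def field_simps power2_eq_square)
    finally have "?E (\<lambda>p. exp (- l * d p)) \<le> r" .
    then show ?thesis
      by (subst nn_integral_eq_integral) (auto intro!: int ennreal_leI)
  qed
  let ?S = "\<lambda>T \<omega>. \<Sum>t<T. d (\<omega> t)"
  have meas_S [measurable]: "?S T \<in> borel_measurable (play \<sigma> \<tau>)" for T
    by measurable
  define E where "E T = {\<omega> \<in> space (play \<sigma> \<tau>). ?S T \<omega> \<le> 0}" for T
  have E_meas [measurable]: "E T \<in> sets (play \<sigma> \<tau>)" for T
    unfolding E_def by measurable
  have E_le: "measure (play \<sigma> \<tau>) (E T) \<le> r ^ T" for T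
  proof -
    have "emeasure (play \<sigma> \<tau>) (E T) = (\<integral>\<^sup>+\<omega>. indicator (E T) \<omega> \<partial>play \<sigma> \<tau>)"
      by simp
    also have "\<dots> \<le> (\<integral>\<^sup>+\<omega>. (\<Prod>t<T. ennreal (exp (- l * d (\<omega> t)))) \<partial>play \<sigma> \<tau>)"
    proof (rule nn_integral_mono)
      fix \<omega>
      have "(\<Prod>t<T. ennreal (exp (- l * d (\<omega> t)))) = ennreal (exp (- l * ?S T \<omega>))"
        by (simp add: prod_ennreal exp_sum sum_distrib_left sum_negf[symmetric] del: sum_negf)
      moreover have "1 \<le> exp (- l * ?S T \<omega>)" if "?S T \<omega> \<le> 0"
        using that l by (simp add: mult_nonneg_nonpos)
      ultimately show "indicator (E T) \<omega> \<le> (\<Prod>t<T. ennreal (exp (- l * d (\<omega> t))))"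
        by (auto simp: E_def split: split_indicator)
    qed
    also have "\<dots> \<le> ennreal r ^ T"
      by (rule nn_integral_prod_play_le[OF contract])
    also have "\<dots> = ennreal (r ^ T)" using r0 by (simp add: ennreal_power)
    finally show ?thesis using r0 by (simp add: emeasure_eq_measure)
  qed
  have "AE \<omega> in play \<sigma> \<tau>. \<forall>\<^sub>F T in sequentially. \<omega> \<in> space (play \<sigma> \<tau>) - E T"
  proof (rule borel_cantelli_AE1)
    show "summable (\<lambda>T. measure (play \<sigma> \<tau>) (E T))"
      using E_le r0 r1 by (intro summable_comparison_test'[OF summable_geometric[of r]]) auto
  qed (auto simp: emeasure_eq_measure)
  then show ?thesis
    by (rule AE_mp) (auto simp: E_def not_le elim: eventually_mono)
qed

section \<open>What Player 1 guarantees in the repeated game\<close>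

lemma stage_payoff_uniform_costs_bounds:
  assumes "\<And>i j. 0 \<le> A $ i $ j" and "\<And>i j. A $ i $ j \<le> 1" and "0 \<le> c"
  shows "A $ fst (\<omega> t) $ snd (\<omega> t) \<le> stage_payoff A uniform_costs c \<omega> t"
    and "0 \<le> stage_payoff A uniform_costs c \<omega> t"
    and "stage_payoff A uniform_costs c \<omega> t \<le> 1 + c"
  using assms(1,2)[of "fst (\<omega> t)" "snd (\<omega> t)"] assms(3)
  by (auto simp: stage_payoff_def uniform_costs_def)

text \<open>
  Integrals of non-integrable functions are 0 by convention and suprema of unbounded sets of reals
  are unspecified; measurability and boundedness of the limit inferior rule out both and allow
  almost sure bounds to pass to the payoff.
\<close>

lemma
  fixes A :: "real^'n^'m" and \<sigma> :: "('m::finite, 'n::finite) strategy1"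
  assumes A0: "\<And>i j. 0 \<le> A $ i $ j" and A1: "\<And>i j. A $ i $ j \<le> 1" and c: "0 \<le> c"
  shows payoff_uniform_costs_le: "payoff A uniform_costs c \<sigma> \<tau> \<le> 1 + c"
    and payoff_uniform_costs_ge:
      "(AE \<omega> in play \<sigma> \<tau>. \<forall>\<^sub>F T in sequentially.
          w * real T \<le> (\<Sum>t<T. stage_payoff A uniform_costs c \<omega> t)) \<Longrightarrow>
        w \<le> payoff A uniform_costs c \<sigma> \<tau>"
proof -
  interpret prob_space "play \<sigma> \<tau>" by (rule prob_space_play)
  note bounds = stage_payoff_uniform_costs_bounds[of A c, OF A0 A1 c]
  define avg where "avg \<omega> T = (\<Sum>t<T. stage_payoff A uniform_costs c \<omega> t) / real T" for \<omega> T
  define L where "L \<omega> = liminf (\<lambda>T. ereal (avg \<omega> T))" for \<omega>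
  have avg: "0 \<le> avg \<omega> T" "avg \<omega> T \<le> 1 + c" for \<omega> T
  proof -
    show "0 \<le> avg \<omega> T" using bounds(2) by (simp add: avg_def sum_nonneg)
    have "(\<Sum>t<T. stage_payoff A uniform_costs c \<omega> t) \<le> (\<Sum>t<T. 1 + c)"
      using bounds(3) by (rule sum_mono)
    then show "avg \<omega> T \<le> 1 + c" using c
      by (cases "T = 0") (auto simp: avg_def field_simps)
  qed
  have L: "0 \<le> L \<omega>" "L \<omega> \<le> ereal (1 + c)" for \<omega>
  proof -
    show "0 \<le> L \<omega>" unfolding L_def using avg(1) by (intro Liminf_bounded) simp
    have "L \<omega> \<le> limsup (\<lambda>T. ereal (avg \<omega> T))" unfolding L_def by (intro Liminf_le_Limsup) simp
    also have "\<dots> \<le> ereal (1 + c)" using avg(2) by (intro Limsup_bounded) simp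
    finally show "L \<omega> \<le> ereal (1 + c)" .
  qed
  have L_real: "ereal (real_of_ereal (L \<omega>)) = L \<omega>" for \<omega>
    using L[of \<omega>] by (intro ereal_real') auto
  have realL: "0 \<le> real_of_ereal (L \<omega>)" "real_of_ereal (L \<omega>) \<le> 1 + c" for \<omega>
  proof -
    show "0 \<le> real_of_ereal (L \<omega>)" using L(1) by (rule real_of_ereal_pos)
    have "ereal (real_of_ereal (L \<omega>)) \<le> ereal (1 + c)" unfolding L_real by (rule L(2))
    then show "real_of_ereal (L \<omega>) \<le> 1 + c" by (simp only: ereal_less_eq)
  qed
  have [measurable]: "(\<lambda>\<omega>. stage_payoff A uniform_costs c \<omega> t) \<in> borel_measurable (play \<sigma> \<tau>)" for t
  proof -
    have pair: "(\<lambda>\<omega>. (\<omega> t, \<omega> (t - 1))) \<in> measurable (play \<sigma> \<tau>) (count_space UNIV)"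
      using measurable_Pair[OF measurable_play_component[of t \<sigma> \<tau>]
          measurable_play_component[of "t - 1" \<sigma> \<tau>]]
      by (simp add: pair_measure_countable)
    show ?thesis
      using measurable_compose[OF pair, of "\<lambda>(p, q). A $ fst p $ snd p +
            (if t = 0 then 0 else c * uniform_costs $ snd q $ snd p)" borel]
      by (simp add: stage_payoff_def[abs_def])
  qed
  have L_meas: "(\<lambda>\<omega>. real_of_ereal (L \<omega>)) \<in> borel_measurable (play \<sigma> \<tau>)"
    unfolding L_def avg_def by measurable
  have int: "integrable (play \<sigma> \<tau>) (\<lambda>\<omega>. real_of_ereal (L \<omega>))"
  proof (rule integrable_const_bound[OF AE_I2 L_meas])
    show "norm (real_of_ereal (L \<omega>)) \<le> 1 + c" for \<omega>
      using realL[of \<omega>] by (simp only: real_norm_def abs_of_nonneg)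
  qed
  have payoff: "payoff A uniform_costs c \<sigma> \<tau> = (LINT \<omega>|play \<sigma> \<tau>. real_of_ereal (L \<omega>))"
    by (simp add: payoff_def L_def avg_def)
  show "payoff A uniform_costs c \<sigma> \<tau> \<le> 1 + c"
    unfolding payoff using realL by (intro integral_le_const int) auto
  show "w \<le> payoff A uniform_costs c \<sigma> \<tau>"
    if ev: "AE \<omega> in play \<sigma> \<tau>. \<forall>\<^sub>F T in sequentially.
          w * real T \<le> (\<Sum>t<T. stage_payoff A uniform_costs c \<omega> t)"
    unfolding payoff
  proof (rule integral_ge_const[OF int], rule AE_mp[OF ev], intro AE_I2 impI)
    fix \<omega>
    assume "\<forall>\<^sub>F T in sequentially. w * real T \<le> (\<Sum>t<T. stage_payoff A uniform_costs c \<omega> t)"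
    then have "\<forall>\<^sub>F T in sequentially. ereal w \<le> ereal (avg \<omega> T)"
      using eventually_gt_at_top[of 0]
      by eventually_elim (simp add: avg_def field_simps)
    then have "ereal w \<le> L \<omega>" unfolding L_def by (rule Liminf_bounded)
    then show "w \<le> real_of_ereal (L \<omega>)" by (metis L_real ereal_less_eq(3))
  qed
qed

lemma mixed_pmf: "(\<chi> j. pmf p j) \<in> mixed"
  for p :: "'k::finite pmf"
  by (simp add: mixed_def sum_pmf_eq_1)

text \<open>
  Player 1's reply depends on the strategy he faces, so the hypothesis is only that every single
  mixed column can be answered, and the lower bound is obtained on the infimum over Player 2's
  strategies.
\<close>

lemma game_value_ge:
  fixes A :: "real^'n^'m"
  assumes A0: "\<And>i j. 0 \<le> A $ i $ j" and A1: "\<And>i j. A $ i $ j \<le> 1" and c: "0 \<le> c"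
    and v: "is_game_value A uniform_costs c v"
    and w: "\<And>y. y \<in> mixed \<Longrightarrow> \<exists>i. w \<le> (A *v y) $ i"
  shows "w \<le> v"
proof -
  have "w \<le> (SUP \<sigma>. payoff A uniform_costs c \<sigma> \<tau>)" for \<tau> :: "('m, 'n) strategy2"
  proof -
    from w[OF mixed_pmf] have "\<forall>h. \<exists>i. w \<le> (A *v (\<chi> j. pmf (\<tau> h) j)) $ i"
      by blast
    then obtain reply where reply: "\<And>h. w \<le> (A *v (\<chi> j. pmf (\<tau> h) j)) $ reply h"
      by metis
    \<comment> \<open>A best reply to the mixed column that \<open>\<tau>\<close> is about to play.\<close>
    define \<sigma> :: "('m, 'n) strategy1" where "\<sigma> h = return_pmf (reply h)" for h
    have "w \<le> payoff A uniform_costs c \<sigma> \<tau>"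
    proof (rule field_le_epsilon)
      fix e :: real assume e: "0 < e"
      define d where "d p = A $ fst p $ snd p - (w - e)" for p
      have drift: "e \<le> measure_pmf.expectation (pair_pmf (\<sigma> h) (\<tau> h)) d" for h
      proof -
        have "measure_pmf.expectation (pair_pmf (\<sigma> h) (\<tau> h)) d
            = measure_pmf.expectation (\<tau> h) (\<lambda>j. A $ reply h $ j - (w - e))"
          by (simp add: \<sigma>_def pair_return_pmf1 d_def)
        also have "\<dots> = measure_pmf.expectation (\<tau> h) (\<lambda>j. A $ reply h $ j) - (w - e)"
          by (subst Bochner_Integration.integral_diff) (auto intro: integrable_measure_pmf_finite)
        also have "measure_pmf.expectation (\<tau> h) (\<lambda>j. A $ reply h $ j)
            = (A *v (\<chi> j. pmf (\<tau> h) j)) $ reply h"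
          by (subst integral_measure_pmf_real[of UNIV]) (auto simp: matrix_vector_mult_def)
        finally show ?thesis using reply[of h] by simp
      qed
      have "w - e \<le> payoff A uniform_costs c \<sigma> \<tau>"
      proof (rule payoff_uniform_costs_ge[OF A0 A1 c], rule AE_mp[OF AE_play_sum_pos[OF drift e]],
          intro AE_I2 impI)
        fix \<omega> assume "\<forall>\<^sub>F T in sequentially. 0 < (\<Sum>t<T. d (\<omega> t))"
        then show "\<forall>\<^sub>F T in sequentially.
            (w - e) * real T \<le> (\<Sum>t<T. stage_payoff A uniform_costs c \<omega> t)"
        proof (rule eventually_mono)
          fix T assume "0 < (\<Sum>t<T. d (\<omega> t))"
          then have "(w - e) * real T \<le> (\<Sum>t<T. A $ fst (\<omega> t) $ snd (\<omega> t))"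
            by (simp add: d_def sum_subtractf mult.commute)
          also have "\<dots> \<le> (\<Sum>t<T. stage_payoff A uniform_costs c \<omega> t)"
            by (intro sum_mono stage_payoff_uniform_costs_bounds(1) A0 A1 c)
          finally show "(w - e) * real T \<le> (\<Sum>t<T. stage_payoff A uniform_costs c \<omega> t)" .
        qed
      qed
      then show "w \<le> payoff A uniform_costs c \<sigma> \<tau> + e" by simp
    qed
    moreover have "bdd_above (range (\<lambda>\<sigma>. payoff A uniform_costs c \<sigma> \<tau>))"
      using payoff_uniform_costs_le[OF A0 A1 c] by (intro bdd_aboveI2)
    ultimately show ?thesis by (intro cSUP_upper2[of _ _ \<sigma>]) auto
  qed
  then have "w \<le> (INF \<tau>. SUP \<sigma>. payoff A uniform_costs c \<sigma> \<tau>)"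
    by (intro cINF_greatest) auto
  then show ?thesis using v by (simp add: is_game_value_def)
qed

section \<open>The static value\<close>

lemma axis_in_mixed: "axis k 1 \<in> mixed"
  by (simp add: mixed_def axis_def)

lemma mixed_inner_le:
  assumes "x \<in> mixed" and "\<And>i. z $ i \<le> K"
  shows "x \<bullet> z \<le> K"
proof -
  have "x \<bullet> z = (\<Sum>i\<in>UNIV. x $ i * z $ i)" by (simp add: inner_vec_def)
  also have "\<dots> \<le> (\<Sum>i\<in>UNIV. x $ i * K)"
    using assms by (intro sum_mono mult_left_mono) (auto simp: mixed_def)
  also have "\<dots> = K" using assms(1) by (simp add: sum_distrib_right[symmetric] mixed_def)
  finally show ?thesis .
qed

text \<open>The probability that two independent draws from \<open>y\<close> differ.\<close>

lemma uniform_costs_static: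
  assumes "y \<in> mixed"
  shows "y \<bullet> (uniform_costs *v y) = 1 - (\<Sum>j\<in>UNIV. (y $ j)\<^sup>2)"
proof -
  have "(uniform_costs *v y) $ j = 1 - y $ j" for j
  proof -
    have "(uniform_costs *v y) $ j = (\<Sum>k\<in>UNIV. y $ k - (if j = k then y $ k else 0))"
      by (auto simp: matrix_vector_mult_def uniform_costs_def intro!: sum.cong)
    also have "\<dots> = 1 - y $ j" using assms by (simp add: sum_subtractf mixed_def)
    finally show ?thesis .
  qed
  then have "y \<bullet> (uniform_costs *v y) = (\<Sum>j\<in>UNIV. y $ j - (y $ j)\<^sup>2)"
    by (simp add: inner_vec_def power2_eq_square right_diff_distrib)
  then show ?thesis using assms by (simp add: sum_subtractf mixed_def)
qed

lemma uniform_costs_static_bounds: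
  fixes y :: "real^'n"
  assumes "y \<in> mixed"
  shows "0 \<le> y \<bullet> (uniform_costs *v y)"
    and "y \<bullet> (uniform_costs *v y) \<le> 1 - 1 / real CARD('n)"
proof -
  have y: "0 \<le> y $ j" "y $ j \<le> 1" for j
    using assms member_le_sum[of j UNIV "\<lambda>j. y $ j"] by (auto simp: mixed_def)
  have "(\<Sum>j\<in>UNIV. (y $ j)\<^sup>2) \<le> (\<Sum>j\<in>UNIV. y $ j)"
    using y by (intro sum_mono) (simp add: power2_eq_square mult_left_le)
  then show "0 \<le> y \<bullet> (uniform_costs *v y)"
    using assms by (simp add: uniform_costs_static mixed_def)
  have "(\<Sum>j\<in>UNIV. y $ j)\<^sup>2 \<le> real CARD('n) * (\<Sum>j\<in>UNIV. (y $ j)\<^sup>2)"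
    using sum_squared_le_sum_of_squares[of "\<lambda>j. y $ j" UNIV]
    by (simp add: mult.commute)
  then have "1 / real CARD('n) \<le> (\<Sum>j\<in>UNIV. (y $ j)\<^sup>2)"
    using assms by (simp add: mixed_def field_simps)
  then show "y \<bullet> (uniform_costs *v y) \<le> 1 - 1 / real CARD('n)"
    using assms by (simp add: uniform_costs_static)
qed

text \<open>
  The nonnegativity of \<open>A\<close> and \<open>c\<close> bounds the costs of all static strategies from below, so that
  their infimum is at most the cost of each one.
\<close>

lemma static_value_le:
  fixes A :: "real^'n^'m" and y :: "real^'n"
  assumes A0: "\<And>i j. 0 \<le> A $ i $ j" and c: "0 \<le> c"
    and y: "y \<in> mixed" and K: "\<And>i. (A *v y) $ i \<le> K"
  shows "static_value A uniform_costs c \<le> K + c * (y \<bullet> (uniform_costs *v y))"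
proof -
  let ?f = "\<lambda>y x. x \<bullet> (A *v y) + c * (y \<bullet> (uniform_costs *v y))"
  have nonneg: "0 \<le> (SUP x\<in>mixed. ?f y x)" if y: "y \<in> mixed" for y :: "real^'n"
  proof -
    obtain k :: 'm where True by blast
    have "?f y x \<le> Max (range (\<lambda>i. (A *v y) $ i)) + c * (y \<bullet> (uniform_costs *v y))"
      if "x \<in> mixed" for x
      using mixed_inner_le[OF that, of "A *v y"] by simp
    then have bdd: "bdd_above (?f y ` mixed)" by (intro bdd_aboveI2)
    have "0 \<le> (A *v y) $ k"
      using A0 y by (auto simp: matrix_vector_mult_def mixed_def intro!: sum_nonneg)
    then have "0 \<le> ?f y (axis k 1)"
      using c uniform_costs_static_bounds(1)[OF y] by (simp add: inner_axis')
    then show ?thesis by (rule cSUP_upper2[OF bdd axis_in_mixed])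
  qed
  have "static_value A uniform_costs c \<le> (SUP x\<in>mixed. ?f y x)"
    unfolding static_value_def
    by (rule cINF_lower[OF _ y]) (rule bdd_belowI2, rule nonneg)
  also have "\<dots> \<le> K + c * (y \<bullet> (uniform_costs *v y))"
    using axis_in_mixed mixed_inner_le[OF _ K] by (intro cSUP_least) auto
  finally show ?thesis .
qed

section \<open>The loss from static strategies\<close>

theorem theorem4:
  fixes A :: "real^'n^'m" and c v :: real
  assumes "Min (range (\<lambda>(i, j). A $ i $ j)) = 0"
    and "Max (range (\<lambda>(i, j). A $ i $ j)) = 1"
    and "0 \<le> c"
    and "is_game_value A uniform_costs c v"
  shows "static_value A uniform_costs c - v
           \<le> 1 / 2 * (1 + c * (1 - 1 / real CARD('n)) - v)"
proof -
  let ?s = "static_value A uniform_costs c"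
  have A0: "0 \<le> A $ i $ j" for i j
    unfolding assms(1)[symmetric] by (rule Min_le) (auto intro: range_eqI[of _ _ "(i, j)"])
  have A1: "A $ i $ j \<le> 1" for i j
    unfolding assms(2)[symmetric] by (rule Max_ge) (auto intro: range_eqI[of _ _ "(i, j)"])
  have s_le_1: "?s \<le> 1"
  proof -
    fix k :: 'n
    have "axis k 1 \<bullet> (uniform_costs *v axis k (1::real)) = 0"
      by (simp add: inner_axis' matrix_vector_mult_basis column_def uniform_costs_def)
    with static_value_le[OF A0 assms(3) axis_in_mixed[of k], of 1] A1 show ?thesis
      by (simp add: matrix_vector_mult_basis column_def)
  qed
  have "?s - c * (1 - 1 / real CARD('n)) \<le> v"
  proof (rule game_value_ge[OF A0 A1 assms(3,4)])
    fix y :: "real^'n" assume y: "y \<in> mixed"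
    let ?K = "Max (range (\<lambda>i. (A *v y) $ i))"
    have "?s \<le> ?K + c * (y \<bullet> (uniform_costs *v y))"
      by (rule static_value_le[OF A0 assms(3) y]) simp
    moreover have "c * (y \<bullet> (uniform_costs *v y)) \<le> c * (1 - 1 / real CARD('n))"
      using uniform_costs_static_bounds(2)[OF y] assms(3) by (rule mult_left_mono)
    moreover have "?K \<in> range (\<lambda>i. (A *v y) $ i)" by (rule Max_in) auto
    then obtain i where "?K = (A *v y) $ i" by blast
    ultimately have "?s - c * (1 - 1 / real CARD('n)) \<le> (A *v y) $ i" by linarith
    then show "\<exists>i. ?s - c * (1 - 1 / real CARD('n)) \<le> (A *v y) $ i" ..
  qed
  with s_le_1 show ?thesis by simp
qed

end
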